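(* For $\gamma>1$, let $T(\gamma)$ denote the minimum time $T$ in the following control problem: find a Lebesgue measurable control $u$ with $-1\le u(t)\le 1$ such that, starting from $(x_1(0),x_2(0))=(1,0)$, the system $$\dot x_1=x_2,\qquad \dot x_2=-u x_1+\frac{1}{x_1^2}$$ reaches the final point $(x_1(T),x_2(T))=(\gamma,0)$ in minimum time $T$, under the state constraint $x_2(t)\ge 0$. Then $T(\gamma)\sim\ln\gamma$ as $\gamma\to\infty$, i.e. $\lim_{\gamma\to\infty}T(\gamma)/\ln\gamma=1$.
   Context: The state $(x_1,x_2)$ lies in $D=\{(x_1,x_2)\in\mathbb{R}^2: x_1>0,\ x_2\ge 0\}$. Admissible controls are Lebesgue measurable functions with values in $[-1,1]$ (almost everywhere); the corresponding trajectories are the absolutely continuous solutions of the system. *)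

theory Defs
  imports "HOL-Analysis.Analysis"
begin

text \<open>
  Absolute continuity of functions is not in HOL-Analysis (the constant
  \<open>absolutely_continuous\<close> there concerns measures). This is the usual epsilon-delta
  definition: \<open>d division_of \<Union>d\<close> says exactly that \<open>d\<close> is a finite family of nonempty
  compact intervals with pairwise disjoint interiors; for such an interval, \<open>Inf K\<close> and
  \<open>Sup K\<close> are its endpoints.
\<close>

definition absolutely_continuous_on :: "real set \<Rightarrow> (real \<Rightarrow> real) \<Rightarrow> bool" where
  "absolutely_continuous_on S f \<longleftrightarrow>
     (\<forall>\<epsilon>>0. \<exists>\<delta>>0. \<forall>d. d division_of \<Union>d \<and> \<Union>d \<subseteq> S \<and> (\<Sum>K\<in>d. Sup K - Inf K) < \<delta> \<longrightarrow>
        (\<Sum>K\<in>d. \<bar>f (Sup K) - f (Inf K)\<bar>) < \<epsilon>)"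

definition state_space :: "(real \<times> real) set" where
  "state_space = {(x1, x2). x1 > 0 \<and> x2 \<ge> 0}"

definition admissible_control :: "real \<Rightarrow> (real \<Rightarrow> real) \<Rightarrow> bool" where
  "admissible_control T u \<longleftrightarrow>
     u \<in> borel_measurable (lebesgue_on {0..T}) \<and>
     (AE t in lebesgue_on {0..T}. -1 \<le> u t \<and> u t \<le> 1)"

definition trajectory :: "real \<Rightarrow> (real \<Rightarrow> real) \<Rightarrow> (real \<Rightarrow> real) \<Rightarrow> (real \<Rightarrow> real) \<Rightarrow> bool" where
  "trajectory T u x1 x2 \<longleftrightarrow>
     absolutely_continuous_on {0..T} x1 \<and>
     absolutely_continuous_on {0..T} x2 \<and>
     (\<forall>t\<in>{0..T}. (x1 t, x2 t) \<in> state_space) \<and>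
     (AE t in lebesgue_on {0..T}.
        (x1 has_real_derivative x2 t) (at t within {0..T}) \<and>
        (x2 has_real_derivative - u t * x1 t + 1 / (x1 t)\<^sup>2) (at t within {0..T}))"

definition transfer_time :: "real \<Rightarrow> real \<Rightarrow> bool" where
  "transfer_time \<gamma> T \<longleftrightarrow>
     T \<ge> 0 \<and>
     (\<exists>u x1 x2. admissible_control T u \<and> trajectory T u x1 x2 \<and>
        (x1 0, x2 0) = (1, 0) \<and> (x1 T, x2 T) = (\<gamma>, 0))"

text \<open>
  A genuine minimum, not an infimum: \<open>LEAST\<close> is an unspecified real number unless the
  minimum is attained.
\<close>

definition minimum_time :: "real \<Rightarrow> real" where
  "minimum_time \<gamma> = (LEAST T. transfer_time \<gamma> T)"

end

theory Submission
  imports Defs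
begin

text \<open>
  The control enters linearly, so two energy-like quantities bound the speed \<open>x\<^sub>2\<close> at a given
  position \<open>x\<^sub>1 = x\<close>. Since \<open>(x\<^sub>2\<^sup>2)' = 2 x\<^sub>2 (- u x\<^sub>1 + 1 / x\<^sub>1\<^sup>2)\<close> with \<open>-1 \<le> u \<le> 1\<close>, accelerating
  from rest at \<open>1\<close> gives at most \<open>x\<^sub>2\<^sup>2 = x\<^sup>2 + 1 - 2 / x\<close> (attained by \<open>u = -1\<close>), and coming to
  rest at \<open>\<gamma>\<close> requires at most \<open>x\<^sub>2\<^sup>2 = \<gamma>\<^sup>2 - x\<^sup>2 + 2 / \<gamma> - 2 / x\<close> (attained by \<open>u = 1\<close>).
  The state constraint makes \<open>x\<^sub>1\<close> increasing, so the transfer takes at least the integral \<open>T\<close> of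
  \<open>dx / v\<close> over \<open>[1, \<gamma>]\<close>, where \<open>v\<close> is the top speed, the root of the smaller of the two bounds
  (\<open>travel_time_minimal\<close>).
  The bang-bang control which switches from \<open>-1\<close> to \<open>1\<close> where the two bounds agree has speed
  exactly \<open>v\<close>, so \<open>T\<close> is attained (\<open>transfer_time_travel_time\<close>): it is the minimum.
  
  For the asymptotics, \<open>v \<le> x + 1\<close> gives \<open>T \<ge> ln (\<gamma> + 1) - ln 2\<close>. In the other direction,
  \<open>1 / v\<close> is at most the sum of a term \<open>1 / sqrt (x\<^sup>2 - 1)\<close> from the acceleration bound, with integral
  \<open>arcosh \<gamma> \<le> ln (2 \<gamma>)\<close>, and a term from the braking bound whose integral is at most \<open>2\<close>.
  Hence \<open>T\<close> differs from \<open>ln \<gamma>\<close> by a bounded amount.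
  
  For arbitrary measurable controls the monotonicity arguments rest on one fact about absolutely
  continuous functions: a derivative that is nonnegative almost everywhere makes the function
  increasing (\<open>absolutely_continuous_on_mono\<close>).
\<close>

section \<open>Absolutely continuous functions\<close>

lemma division_member:
  fixes d :: "real set set"
  assumes "d division_of S" "K \<in> d"
  shows "Inf K \<in> S" "Sup K \<in> S" "Inf K \<le> Sup K" "K = {Inf K..Sup K}"
proof -
  obtain u v where K: "K = cbox u v" and "K \<noteq> {}" "K \<subseteq> S"
    using division_ofD(2-4)[OF assms] by blast
  then show "Inf K \<in> S" "Sup K \<in> S" "Inf K \<le> Sup K" "K = {Inf K..Sup K}"
    by (auto simp: subset_eq)
qed

lemma absolutely_continuous_onE:
  assumes "absolutely_continuous_on S f" "\<epsilon> > 0"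
  obtains \<delta> where "\<delta> > 0"
    "\<And>d. d division_of \<Union>d \<Longrightarrow> \<Union>d \<subseteq> S \<Longrightarrow> (\<Sum>K\<in>d. Sup K - Inf K) < \<delta> \<Longrightarrow>
        (\<Sum>K\<in>d. \<bar>f (Sup K) - f (Inf K)\<bar>) < \<epsilon>"
proof -
  obtain \<delta> where "\<delta> > 0" "\<forall>d. d division_of \<Union>d \<and> \<Union>d \<subseteq> S \<and> (\<Sum>K\<in>d. Sup K - Inf K) < \<delta> \<longrightarrow>
        (\<Sum>K\<in>d. \<bar>f (Sup K) - f (Inf K)\<bar>) < \<epsilon>"
    using assms unfolding absolutely_continuous_on_def by blast
  then show thesis using that[of \<delta>] by simp
qed

lemma absolutely_continuous_on_subset:
  assumes "absolutely_continuous_on S f" "S' \<subseteq> S"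
  shows "absolutely_continuous_on S' f"
  using assms unfolding absolutely_continuous_on_def by (meson order_trans)

text \<open>
  Covers sums, Lipschitz images and products of bounded absolutely continuous functions at once: the
  energies below depend on position and speed through a function that is Lipschitz on the compact
  range of the trajectory.
\<close>

lemma absolutely_continuous_on_compose2:
  assumes f: "absolutely_continuous_on S f" and g: "absolutely_continuous_on S g"
    and h: "\<And>s t. s \<in> S \<Longrightarrow> t \<in> S \<Longrightarrow> \<bar>h t - h s\<bar> \<le> C * (\<bar>f t - f s\<bar> + \<bar>g t - g s\<bar>)"
    and C: "C > 0"
  shows "absolutely_continuous_on S h"
  unfolding absolutely_continuous_on_def
proof (intro allI impI)
  fix \<epsilon> :: real assume "\<epsilon> > 0"
  then have e: "\<epsilon> / (2 * C) > 0" using C by simp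
  obtain \<delta>1 where d1: "\<delta>1 > 0"
    "\<And>d. d division_of \<Union>d \<Longrightarrow> \<Union>d \<subseteq> S \<Longrightarrow> (\<Sum>K\<in>d. Sup K - Inf K) < \<delta>1 \<Longrightarrow>
        (\<Sum>K\<in>d. \<bar>f (Sup K) - f (Inf K)\<bar>) < \<epsilon> / (2 * C)"
    using absolutely_continuous_onE[OF f e] by blast
  obtain \<delta>2 where d2: "\<delta>2 > 0"
    "\<And>d. d division_of \<Union>d \<Longrightarrow> \<Union>d \<subseteq> S \<Longrightarrow> (\<Sum>K\<in>d. Sup K - Inf K) < \<delta>2 \<Longrightarrow>
        (\<Sum>K\<in>d. \<bar>g (Sup K) - g (Inf K)\<bar>) < \<epsilon> / (2 * C)"
    using absolutely_continuous_onE[OF g e] by blast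
  show "\<exists>\<delta>>0. \<forall>d. d division_of \<Union>d \<and> \<Union>d \<subseteq> S \<and> (\<Sum>K\<in>d. Sup K - Inf K) < \<delta> \<longrightarrow>
        (\<Sum>K\<in>d. \<bar>h (Sup K) - h (Inf K)\<bar>) < \<epsilon>"
  proof (intro exI[of _ "min \<delta>1 \<delta>2"] conjI allI impI; (elim conjE)?)
    show "min \<delta>1 \<delta>2 > 0" using d1 d2 by simp
    fix d assume d: "d division_of \<Union>d" "\<Union>d \<subseteq> S" "(\<Sum>K\<in>d. Sup K - Inf K) < min \<delta>1 \<delta>2"
    have "Inf K \<in> S" "Sup K \<in> S" if "K \<in> d" for K
      using d(2) division_member[OF d(1) that] by auto
    then have "(\<Sum>K\<in>d. \<bar>h (Sup K) - h (Inf K)\<bar>) \<le>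
        (\<Sum>K\<in>d. C * (\<bar>f (Sup K) - f (Inf K)\<bar> + \<bar>g (Sup K) - g (Inf K)\<bar>))"
      by (intro sum_mono h)
    also have "\<dots> = C * ((\<Sum>K\<in>d. \<bar>f (Sup K) - f (Inf K)\<bar>) + (\<Sum>K\<in>d. \<bar>g (Sup K) - g (Inf K)\<bar>))"
      by (simp add: sum.distrib flip: sum_distrib_left)
    also have "\<dots> < C * (\<epsilon> / (2 * C) + \<epsilon> / (2 * C))"
      using d1(2)[of d] d2(2)[of d] d C by (intro mult_strict_left_mono add_strict_mono) auto
    finally show "(\<Sum>K\<in>d. \<bar>h (Sup K) - h (Inf K)\<bar>) < \<epsilon>"
      using C by simp
  qed
qed

lemma absolutely_continuous_on_ident: "absolutely_continuous_on S (\<lambda>t. t)"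
  unfolding absolutely_continuous_on_def
proof (intro allI impI)
  fix \<epsilon> :: real assume "\<epsilon> > 0"
  have "(\<Sum>K\<in>d. \<bar>Sup K - Inf K\<bar>) = (\<Sum>K\<in>d. Sup K - Inf K)"
    if "d division_of \<Union>d" for d :: "real set set"
    using division_member(3)[OF that] by (intro sum.cong) auto
  then show "\<exists>\<delta>>0. \<forall>d. d division_of \<Union>d \<and> \<Union>d \<subseteq> S \<and> (\<Sum>K\<in>d. Sup K - Inf K) < \<delta> \<longrightarrow>
        (\<Sum>K\<in>d. \<bar>Sup K - Inf K\<bar>) < \<epsilon>"
    using \<open>\<epsilon> > 0\<close> by auto
qed

lemma absolutely_continuous_on_imp_continuous_on:
  assumes "absolutely_continuous_on {a..b} f"
  shows "continuous_on {a..b} f"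
  unfolding continuous_on_iff
proof (intro ballI allI impI)
  fix s \<epsilon> :: real assume s: "s \<in> {a..b}" and "\<epsilon> > 0"
  then obtain \<delta> where d: "\<delta> > 0"
    "\<And>d. d division_of \<Union>d \<Longrightarrow> \<Union>d \<subseteq> {a..b} \<Longrightarrow> (\<Sum>K\<in>d. Sup K - Inf K) < \<delta> \<Longrightarrow>
        (\<Sum>K\<in>d. \<bar>f (Sup K) - f (Inf K)\<bar>) < \<epsilon>"
    using absolutely_continuous_onE[OF assms] by blast
  have small: "\<bar>f v - f u\<bar> < \<epsilon>" if "u \<in> {a..b}" "v \<in> {a..b}" "u \<le> v" "v - u < \<delta>" for u v
  proof -
    have "{{u..v}} division_of \<Union>{{u..v}}"
      using division_of_self[of u v] that(3) by simp
    then show ?thesis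
      using d(2)[of "{{u..v}}"] that by auto
  qed
  show "\<exists>d>0. \<forall>t\<in>{a..b}. dist t s < d \<longrightarrow> dist (f t) (f s) < \<epsilon>"
  proof (intro exI[of _ \<delta>] conjI ballI impI)
    fix t assume "t \<in> {a..b}" "dist t s < \<delta>"
    then show "dist (f t) (f s) < \<epsilon>"
      using small[of s t] small[of t s] s by (cases "s \<le> t") (auto simp: dist_real_def abs_if split: if_splits)
  qed (use d in auto)
qed

text \<open>
  Such a function is Lipschitz, by the fundamental theorem of calculus with finitely many
  exceptional points. The exceptions are the instants where the optimal speed has no derivative.
\<close>

lemma absolutely_continuous_on_bounded_derivative:
  assumes cont: "continuous_on {a..b} f" and S: "finite S"
    and der: "\<And>t. t \<in> {a<..<b} - S \<Longrightarrow> (f has_real_derivative f' t) (at t)"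
    and bound: "\<And>t. t \<in> {a<..<b} - S \<Longrightarrow> \<bar>f' t\<bar> \<le> C"
    and C: "C > 0"
  shows "absolutely_continuous_on {a..b} f"
proof -
  have lip: "\<bar>f t - f s\<bar> \<le> C * (t - s)" if st: "a \<le> s" "s \<le> t" "t \<le> b" for s t
  proof -
    have "(f' has_integral (f t - f s)) {s..t}"
    proof (rule fundamental_theorem_of_calculus_interior_strong[OF S])
      show "continuous_on {s..t} f"
        by (rule continuous_on_subset[OF cont]) (use st in auto)
    qed (use st der in \<open>auto simp flip: has_real_derivative_iff_has_vector_derivative\<close>)
    then have "norm (f t - f s) \<le> C * measure lborel {s..t}"
      by (rule has_integral_bound_real[rotated 2, where S = "insert s (insert t S)"])
        (use st C S bound in auto)
    then show ?thesis using st by simp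
  qed
  show ?thesis
  proof (rule absolutely_continuous_on_compose2[OF absolutely_continuous_on_ident
        absolutely_continuous_on_ident _ C])
    fix s t assume *: "s \<in> {a..b}" "t \<in> {a..b}"
    have "\<bar>f t - f s\<bar> \<le> C * \<bar>t - s\<bar>"
      using lip[of s t] lip[of t s] * by (cases "s \<le> t") auto
    moreover have "0 \<le> C * \<bar>t - s\<bar>" using C by simp
    ultimately show "\<bar>f t - f s\<bar> \<le> C * (\<bar>t - s\<bar> + \<bar>t - s\<bar>)"
      by (simp add: distrib_left)
  qed
qed

text \<open>
  Take a tagged division fine enough that over each interval with tag outside \<open>N\<close> the function
  drops by at most a small multiple of the length, as its derivative at the tag is nonnegative.
  The intervals with tag in \<open>N\<close> lie in an open set of small measure, so absolute continuity
  bounds the sum of the increments over them. The sum over the whole division telescopes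
  to \<open>f b - f a\<close>.
\<close>

lemma absolutely_continuous_on_mono:
  assumes ac: "absolutely_continuous_on {a..b} f" and "a \<le> b" and N: "negligible N"
    and der: "\<And>t. t \<in> {a..b} - N \<Longrightarrow> (f has_real_derivative f' t) (at t within {a..b})"
    and nonneg: "\<And>t. t \<in> {a..b} - N \<Longrightarrow> 0 \<le> f' t"
  shows "f a \<le> f b"
proof (rule field_le_epsilon)
  fix e :: real assume e: "e > 0"
  define c where "c = e / (2 * (b - a + 1))"
  have c: "c > 0" and cab: "c * (b - a) \<le> e / 2"
    using e \<open>a \<le> b\<close> by (auto simp: c_def field_simps)
  obtain \<delta> where \<delta>: "\<delta> > 0"
    and small: "\<And>d. d division_of \<Union>d \<Longrightarrow> \<Union>d \<subseteq> {a..b} \<Longrightarrow> (\<Sum>K\<in>d. Sup K - Inf K) < \<delta> \<Longrightarrow>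
        (\<Sum>K\<in>d. \<bar>f (Sup K) - f (Inf K)\<bar>) < e / 2"
    using absolutely_continuous_onE[OF ac half_gt_zero[OF e]] by blast
  obtain U where U: "open U" "N \<subseteq> U" "U - N \<in> lmeasurable" "emeasure lebesgue (U - N) < ennreal \<delta>"
    using sets_lebesgue_outer_open[OF negligible_imp_sets[OF N] \<delta>] .
  have "U = (U - N) \<union> N" using U(2) by auto
  then have Um: "U \<in> lmeasurable"
    using U(3) N by (metis fmeasurable.Un negligible_imp_measurable)
  have "measure lebesgue U = measure lebesgue (U - N)"
    using Um N by (metis fmeasurableD measure_Diff_null_set negligible_iff_null_sets)
  then have mU: "measure lebesgue U < \<delta>"
    using U(3,4) \<delta> by (simp add: emeasure_eq_measure2 ennreal_less_iff)
  have "\<exists>r>0. t \<in> {a..b} - N \<longrightarrow> (\<forall>s\<in>{a..b}. \<bar>s - t\<bar> < r \<longrightarrow> \<bar>f s - f t - f' t * (s - t)\<bar> \<le> c * \<bar>s - t\<bar>)" for t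
  proof (cases "t \<in> {a..b} - N")
    case True
    then show ?thesis
      using der[OF True] c unfolding has_field_derivative_def has_derivative_within_alt
      by simp
  qed (auto intro: exI[of _ 1])
  then obtain r where r: "\<And>t. r t > 0"
    "\<And>t s. t \<in> {a..b} - N \<Longrightarrow> s \<in> {a..b} \<Longrightarrow> \<bar>s - t\<bar> < r t \<Longrightarrow> \<bar>f s - f t - f' t * (s - t)\<bar> \<le> c * \<bar>s - t\<bar>"
    by metis
  have "gauge (\<lambda>t. if t \<in> N then U else ball t (r t))"
    using U r by (auto simp: gauge_def)
  then obtain p where p: "p tagged_division_of {a..b}"
    and fine: "(\<lambda>t. if t \<in> N then U else ball t (r t)) fine p"
    using fine_division_exists_real by blast
  have mem: "\<exists>u v. K = {u..v} \<and> u \<le> t \<and> t \<le> v \<and> a \<le> u \<and> v \<le> b" if tK: "(t, K) \<in> p" for t K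
  proof -
    obtain u v where "K = cbox u v" "t \<in> K" "K \<subseteq> {a..b}"
      using tagged_division_ofD(2-4)[OF p tK] by blast
    then show ?thesis by auto
  qed
  define bad where "bad = {x \<in> p. fst x \<in> N}"
  have fin: "finite p" "bad \<subseteq> p" using p by (auto simp: bad_def)
  have bad_tpd: "bad tagged_partial_division_of {a..b}"
    using p fin(2) unfolding tagged_division_of_def by (meson tagged_partial_division_subset)
  then have bad_td: "bad tagged_division_of \<Union>(snd ` bad)"
    by (rule tagged_partial_division_of_Union_self)
  have bad_d: "snd ` bad division_of \<Union>(snd ` bad)"
    by (rule division_of_tagged_division[OF bad_td])
  have bad_U: "\<Union>(snd ` bad) \<subseteq> U"
    using fineD[OF fine] by (fastforce simp: bad_def)
  have "(\<Sum>K\<in>snd ` bad. Sup K - Inf K) = (\<Sum>K\<in>snd ` bad. measure lebesgue K)"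
  proof (rule sum.cong)
    fix K assume "K \<in> snd ` bad"
    note K = division_member(3,4)[OF bad_d this]
    have "measure lebesgue {Inf K..Sup K} = Sup K - Inf K"
      using K(1) by simp
    then show "Sup K - Inf K = measure lebesgue K"
      using K(2) by simp
  qed simp
  also have "\<dots> = measure lebesgue (\<Union>(snd ` bad))"
    using content_division[OF bad_d] by simp
  also have "\<dots> \<le> measure lebesgue U"
    using bad_U Um lmeasurable_division[OF bad_d] by (intro measure_mono_fmeasurable) auto
  finally have "(\<Sum>K\<in>snd ` bad. Sup K - Inf K) < \<delta>" using mU by simp
  then have "(\<Sum>K\<in>snd ` bad. \<bar>f (Sup K) - f (Inf K)\<bar>) < e / 2"
    using tagged_partial_division_ofD(3)[OF bad_tpd] by (intro small bad_d) force
  also have "(\<Sum>K\<in>snd ` bad. \<bar>f (Sup K) - f (Inf K)\<bar>) = (\<Sum>(t, K)\<in>bad. \<bar>f (Sup K) - f (Inf K)\<bar>)"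
  proof -
    \<comment> \<open>An interval that occurs with two different tags is a single point.\<close>
    have "f (Sup K) = f (Inf K)" if tK: "(t, K) \<in> bad" "(t', K) \<in> bad" "t \<noteq> t'" for t t' K
    proof -
      obtain u v where K: "K = {u..v}" "u \<le> v"
        using mem[OF subsetD[OF fin(2) tK(1)]] by auto
      have "interior K \<inter> interior K = {}"
        by (rule tagged_partial_division_ofD(5)[OF bad_tpd tK(1,2)]) (use tK(3) in simp)
      then show ?thesis using K by simp
    qed
    then have "(\<Sum>K\<in>snd ` bad. \<bar>f (Sup K) - f (Inf K)\<bar>) = sum ((\<lambda>K. \<bar>f (Sup K) - f (Inf K)\<bar>) \<circ> snd) bad"
      by (intro sum.reindex_nontrivial finite_subset[OF fin(2,1)]) (auto, metis)
    then show ?thesis by (simp add: case_prod_unfold o_def)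
  qed
  finally have "(\<Sum>(t, K)\<in>bad. \<bar>f (Sup K) - f (Inf K)\<bar>) < e / 2" .
  moreover have "(\<Sum>(t, K)\<in>bad. - \<bar>f (Sup K) - f (Inf K)\<bar>) \<le> (\<Sum>(t, K)\<in>bad. f (Sup K) - f (Inf K))"
    by (rule sum_mono) auto
  ultimately have bad_sum: "- (e / 2) \<le> (\<Sum>(t, K)\<in>bad. f (Sup K) - f (Inf K))"
    by (simp add: case_prod_unfold sum_negf)
  have len: "(\<Sum>(t, K)\<in>p. Sup K - Inf K) = b - a"
    using additive_tagged_division_1[OF \<open>a \<le> b\<close> p, of "\<lambda>x. x"] by simp
  have "- (e / 2) \<le> - c * (\<Sum>(t, K)\<in>p. Sup K - Inf K)"
    using cab len by simp
  also have "\<dots> = (\<Sum>(t, K)\<in>p. - c * (Sup K - Inf K))"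
    by (simp add: sum_distrib_left case_prod_unfold)
  also have "\<dots> \<le> (\<Sum>(t, K)\<in>p - bad. - c * (Sup K - Inf K))"
  proof -
    have "(\<Sum>(t, K)\<in>p. c * (Sup K - Inf K)) \<ge> (\<Sum>(t, K)\<in>p - bad. c * (Sup K - Inf K))"
      using c fin by (intro sum_mono2) (auto dest!: mem)
    then show ?thesis by (simp add: case_prod_unfold sum_negf)
  qed
  also have "\<dots> \<le> (\<Sum>(t, K)\<in>p - bad. f (Sup K) - f (Inf K))"
  proof (rule sum_mono, clarify)
    fix t K assume tK: "(t, K) \<in> p" "(t, K) \<notin> bad"
    then obtain u v where K: "K = {u..v}" "u \<le> t" "t \<le> v" "a \<le> u" "v \<le> b"
      using mem by blast
    have t: "t \<in> {a..b} - N" using tK K by (auto simp: bad_def)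
    have "K \<subseteq> ball t (r t)" using tK fine by (force simp: bad_def fine_def)
    moreover have "u \<in> K" "v \<in> K" using K by auto
    ultimately have "\<bar>u - t\<bar> < r t" "\<bar>v - t\<bar> < r t"
      by (auto simp: dist_real_def abs_minus_commute)
    then have "\<bar>f u - f t - f' t * (u - t)\<bar> \<le> c * \<bar>u - t\<bar>" "\<bar>f v - f t - f' t * (v - t)\<bar> \<le> c * \<bar>v - t\<bar>"
      using r(2)[OF t, of u] r(2)[OF t, of v] K by auto
    moreover have "f' t * (v - t) \<ge> 0" "f' t * (u - t) \<le> 0"
      using nonneg[OF t] K by (auto simp: mult_le_0_iff)
    moreover have "c * \<bar>u - t\<bar> + c * \<bar>v - t\<bar> = c * (v - u)"
      using K by (simp add: algebra_simps)
    ultimately have "- c * (v - u) \<le> f v - f u" by linarith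
    then show "- c * (Sup K - Inf K) \<le> f (Sup K) - f (Inf K)" using K by simp
  qed
  finally have good_sum: "- (e / 2) \<le> (\<Sum>(t, K)\<in>p - bad. f (Sup K) - f (Inf K))" .
  have "f b - f a = (\<Sum>(t, K)\<in>p. f (Sup K) - f (Inf K))"
    using additive_tagged_division_1[OF \<open>a \<le> b\<close> p, of f] by simp
  also have "\<dots> = (\<Sum>(t, K)\<in>p - bad. f (Sup K) - f (Inf K)) + (\<Sum>(t, K)\<in>bad. f (Sup K) - f (Inf K))"
    using sum.subset_diff[OF fin(2,1)] .
  finally show "f a \<le> f b + e" using good_sum bad_sum by linarith
qed

section \<open>The top speed and the travel time\<close>

text \<open>
  Squares of speeds: \<open>accel_bound x\<close> is reached at \<open>x\<close> from rest at \<open>1\<close> under \<open>u = -1\<close>, and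
  \<open>brake_bound \<gamma> x\<close> is the one from which \<open>u = 1\<close> leads to rest at \<open>\<gamma>\<close>.
\<close>

definition accel_bound :: "real \<Rightarrow> real" where
  "accel_bound x = x\<^sup>2 + 1 - 2 / x"

definition brake_bound :: "real \<Rightarrow> real \<Rightarrow> real" where
  "brake_bound \<gamma> x = \<gamma>\<^sup>2 - x\<^sup>2 + 2 / \<gamma> - 2 / x"

definition top_speed :: "real \<Rightarrow> real \<Rightarrow> real" where
  "top_speed \<gamma> x = sqrt (min (accel_bound x) (brake_bound \<gamma> x))"

definition switch_point :: "real \<Rightarrow> real" where
  "switch_point \<gamma> = sqrt ((\<gamma>\<^sup>2 + 2 / \<gamma> - 1) / 2)"

definition travel_time :: "real \<Rightarrow> real \<Rightarrow> real" where
  "travel_time \<gamma> x = integral {1..x} (\<lambda>s. 1 / top_speed \<gamma> s)"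

lemma accel_less_brake_iff:
  assumes "x \<ge> 0"
  shows "accel_bound x < brake_bound \<gamma> x \<longleftrightarrow> x < switch_point \<gamma>"
proof -
  have "x < switch_point \<gamma> \<longleftrightarrow> sqrt (x\<^sup>2) < switch_point \<gamma>"
    using assms by simp
  also have "\<dots> \<longleftrightarrow> x\<^sup>2 < (\<gamma>\<^sup>2 + 2 / \<gamma> - 1) / 2"
    unfolding switch_point_def by (rule real_sqrt_less_iff)
  also have "\<dots> \<longleftrightarrow> accel_bound x < brake_bound \<gamma> x"
    unfolding accel_bound_def brake_bound_def less_divide_eq_numeral1 by (intro iffI; linarith)
  finally show ?thesis by simp
qed

lemma accel_bound_ge:
  assumes "x \<ge> 1"
  shows "x\<^sup>2 - 1 \<le> accel_bound x"
  using assms by (simp add: accel_bound_def field_simps)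

lemma accel_bound_le:
  assumes "x \<ge> 1"
  shows "accel_bound x \<le> (x + 1)\<^sup>2"
proof -
  have "accel_bound x \<le> x\<^sup>2 + 1" using assms by (simp add: accel_bound_def)
  also have "\<dots> \<le> (x + 1)\<^sup>2" using assms by (simp add: power2_sum)
  finally show ?thesis .
qed

text \<open>
  The braking bound has a simple zero at \<open>\<gamma>\<close>: it is the product of \<open>\<gamma> - x\<close> and
  \<open>\<gamma> + x - 2 / (x \<gamma>)\<close>, and the second factor is smallest at \<open>x = 1\<close>.
\<close>

lemma brake_bound_ge:
  assumes "1 \<le> x" "x \<le> \<gamma>"
  shows "(\<gamma> + 1 - 2 / \<gamma>) * (\<gamma> - x) \<le> brake_bound \<gamma> x"
proof -
  have "2 / (x * \<gamma>) \<le> 2 / \<gamma>"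
    using assms by (simp add: field_simps)
  then have "(\<gamma> + 1 - 2 / \<gamma>) * (\<gamma> - x) \<le> (\<gamma> + x - 2 / (x * \<gamma>)) * (\<gamma> - x)"
    using assms by (intro mult_right_mono) auto
  also have "\<dots> = brake_bound \<gamma> x"
    using assms by (simp add: brake_bound_def field_simps power2_eq_square)
  finally show ?thesis .
qed

lemma brake_slope_gt: 
  assumes "\<gamma> > (1::real)"
  shows "\<gamma> - 1 < \<gamma> + 1 - 2 / \<gamma>"
  using assms by (simp add: field_simps)

lemma top_speed_pos:
  assumes "1 < x" "x < \<gamma>"
  shows "top_speed \<gamma> x > 0"
proof -
  have "x\<^sup>2 - 1 > 0" using assms by (simp add: power2_eq_square less_1_mult)
  moreover have "(\<gamma> + 1 - 2 / \<gamma>) * (\<gamma> - x) > 0"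
    using assms brake_slope_gt[of \<gamma>] by (intro mult_pos_pos) auto
  ultimately have "accel_bound x > 0" "brake_bound \<gamma> x > 0"
    using accel_bound_ge[of x] brake_bound_ge[of x \<gamma>] assms by linarith+
  then show ?thesis by (simp add: top_speed_def)
qed

lemma top_speed_le:
  assumes "1 \<le> x"
  shows "top_speed \<gamma> x \<le> x + 1"
proof -
  have "top_speed \<gamma> x \<le> sqrt ((x + 1)\<^sup>2)"
    unfolding top_speed_def using accel_bound_le[OF assms] by (intro real_sqrt_le_mono) auto
  then show ?thesis using assms by simp
qed

lemma top_speed_endpoints:
  assumes "\<gamma> > 1"
  shows "top_speed \<gamma> 1 = 0" "top_speed \<gamma> \<gamma> = 0"
proof -
  have "(\<gamma> + 1 - 2 / \<gamma>) * (\<gamma> - 1) \<ge> 0" "\<gamma>\<^sup>2 - 1 \<ge> 0"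
    using assms brake_slope_gt[OF assms] by simp_all
  then have "brake_bound \<gamma> 1 \<ge> 0" "accel_bound \<gamma> \<ge> 0"
    using brake_bound_ge[of 1 \<gamma>] accel_bound_ge[of \<gamma>] assms by linarith+
  then show "top_speed \<gamma> 1 = 0" "top_speed \<gamma> \<gamma> = 0"
    by (auto simp: top_speed_def accel_bound_def brake_bound_def)
qed

lemma continuous_on_top_speed:
  assumes "0 \<notin> S"
  shows "continuous_on S (top_speed \<gamma>)"
  unfolding top_speed_def accel_bound_def brake_bound_def
  by (intro continuous_intros) (use assms in auto)

lemma top_speed_nonneg:
  assumes "\<gamma> > 1" "x \<in> {1..\<gamma>}"
  shows "top_speed \<gamma> x \<ge> 0"
  using top_speed_pos[of x \<gamma>] top_speed_endpoints[OF assms(1)] assms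
  by (cases "x = 1 \<or> x = \<gamma>") auto

text \<open>
  The top speed vanishes at both endpoints. This majorant has only inverse square root
  singularities there and an explicit primitive, so it serves both for the integrability of
  \<open>1 / top_speed \<gamma>\<close> and for the upper bound on the travel time. At the endpoints themselves the
  inequality holds because \<open>1 / 0 = 0\<close>.
\<close>

lemma inverse_top_speed_le:
  assumes g: "\<gamma> > 1" and x: "x \<in> {1..\<gamma>}"
  shows "1 / top_speed \<gamma> x \<le> 1 / sqrt (x\<^sup>2 - 1) + 1 / (sqrt (\<gamma> + 1 - 2 / \<gamma>) * sqrt (\<gamma> - x))"
proof (cases "x = 1 \<or> x = \<gamma>")
  case True
  have "0 \<le> 1 / sqrt (x\<^sup>2 - 1) + 1 / (sqrt (\<gamma> + 1 - 2 / \<gamma>) * sqrt (\<gamma> - x))"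
    using x g brake_slope_gt[OF g] by (intro add_nonneg_nonneg divide_nonneg_nonneg mult_nonneg_nonneg) auto
  then show ?thesis using True top_speed_endpoints[OF g] by auto
next
  case False
  then have x': "1 < x" "x < \<gamma>" using x by auto
  have a: "0 < sqrt (x\<^sup>2 - 1)" using x' by (simp add: power2_eq_square less_1_mult)
  have b: "0 < sqrt (\<gamma> + 1 - 2 / \<gamma>) * sqrt (\<gamma> - x)" using x' brake_slope_gt[OF g] by simp
  have "sqrt (x\<^sup>2 - 1) \<le> sqrt (accel_bound x)"
    "sqrt (\<gamma> + 1 - 2 / \<gamma>) * sqrt (\<gamma> - x) \<le> sqrt (brake_bound \<gamma> x)"
    using accel_bound_ge[of x] brake_bound_ge[of x \<gamma>] x' unfolding real_sqrt_mult[symmetric]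
    by auto
  then have "1 / sqrt (accel_bound x) \<le> 1 / sqrt (x\<^sup>2 - 1)"
    "1 / sqrt (brake_bound \<gamma> x) \<le> 1 / (sqrt (\<gamma> + 1 - 2 / \<gamma>) * sqrt (\<gamma> - x))"
    using frac_le[OF zero_le_one order.refl a] frac_le[OF zero_le_one order.refl b] by metis+
  moreover have "0 \<le> 1 / sqrt (x\<^sup>2 - 1)" "0 \<le> 1 / (sqrt (\<gamma> + 1 - 2 / \<gamma>) * sqrt (\<gamma> - x))"
    using a b by (simp_all only: zero_le_divide_1_iff less_imp_le)
  ultimately show ?thesis
    unfolding top_speed_def min_def
    by (cases "accel_bound x \<le> brake_bound \<gamma> x"; simp only: if_True if_False; linarith)
qed

lemma majorant_has_integral:
  assumes g: "\<gamma> > 1"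
  shows "((\<lambda>x. 1 / sqrt (x\<^sup>2 - 1) + 1 / (sqrt (\<gamma> + 1 - 2 / \<gamma>) * sqrt (\<gamma> - x))) has_integral
      (arcosh \<gamma> + 2 * sqrt (\<gamma> - 1) / sqrt (\<gamma> + 1 - 2 / \<gamma>))) {1..\<gamma>}"
proof -
  define c where "c = sqrt (\<gamma> + 1 - 2 / \<gamma>)"
  have c: "c > 0" using brake_slope_gt[OF g] g by (simp add: c_def)
  define F where "F x = arcosh x - 2 * sqrt (\<gamma> - x) / c" for x
  have "((\<lambda>x. 1 / sqrt (x\<^sup>2 - 1) + 1 / (c * sqrt (\<gamma> - x))) has_integral (F \<gamma> - F 1)) {1..\<gamma>}"
  proof (rule fundamental_theorem_of_calculus_interior)
    show "continuous_on {1..\<gamma>} F"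
      unfolding F_def by (intro continuous_intros) (use c in auto)
    fix x assume "x \<in> {1<..<\<gamma>}"
    then show "(F has_vector_derivative 1 / sqrt (x\<^sup>2 - 1) + 1 / (c * sqrt (\<gamma> - x))) (at x)"
      unfolding F_def has_real_derivative_iff_has_vector_derivative[symmetric] using c
      by (auto intro!: derivative_eq_intros simp: field_simps)
  qed (use g in simp)
  then show ?thesis by (simp add: F_def c_def)
qed

lemma inverse_top_speed_integrable:
  assumes g: "\<gamma> > 1"
  shows "(\<lambda>x. 1 / top_speed \<gamma> x) integrable_on {1..\<gamma>}"
proof (rule measurable_bounded_by_integrable_imp_integrable_real)
  show "(\<lambda>x. 1 / top_speed \<gamma> x) \<in> borel_measurable (lebesgue_on {1..\<gamma>})"
    unfolding top_speed_def accel_bound_def brake_bound_def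
    by (intro measurable_restrict_space1 measurable_completion) measurable
  show "(\<lambda>x. 1 / sqrt (x\<^sup>2 - 1) + 1 / (sqrt (\<gamma> + 1 - 2 / \<gamma>) * sqrt (\<gamma> - x))) integrable_on {1..\<gamma>}"
    using majorant_has_integral[OF g] by blast
  show "\<bar>1 / top_speed \<gamma> x\<bar> \<le> 1 / sqrt (x\<^sup>2 - 1) + 1 / (sqrt (\<gamma> + 1 - 2 / \<gamma>) * sqrt (\<gamma> - x))"
    if "x \<in> {1..\<gamma>}" for x
    using inverse_top_speed_le[OF g that] top_speed_nonneg[OF g that] by simp
qed simp

lemma travel_time_1 [simp]: "travel_time \<gamma> 1 = 0"
  by (simp add: travel_time_def)

lemma continuous_on_travel_time:
  assumes "\<gamma> > 1"
  shows "continuous_on {1..\<gamma>} (travel_time \<gamma>)"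
  unfolding travel_time_def
  using indefinite_integral_continuous_1[OF inverse_top_speed_integrable[OF assms]] .

lemma travel_time_has_derivative:
  assumes x: "1 < x" "x < \<gamma>"
  shows "(travel_time \<gamma> has_real_derivative 1 / top_speed \<gamma> x) (at x)"
proof -
  have "continuous_on {1<..<\<gamma>} (\<lambda>s. 1 / top_speed \<gamma> s)"
    by (intro continuous_intros continuous_on_top_speed) (use top_speed_pos[of _ \<gamma>] in fastforce)+
  then have "isCont (\<lambda>s. 1 / top_speed \<gamma> s) x"
    using x by (simp add: continuous_on_eq_continuous_at)
  then have "continuous (at x within ({1..\<gamma>} - {})) (\<lambda>s. 1 / top_speed \<gamma> s)"
    by (rule continuous_at_imp_continuous_at_within)
  moreover have "\<gamma> > 1" using x by simp
  ultimately have "(travel_time \<gamma> has_vector_derivative 1 / top_speed \<gamma> x) (at x within ({1..\<gamma>} - {}))"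
    unfolding travel_time_def [abs_def]
    using x by (intro integral_has_vector_derivative_continuous_at inverse_top_speed_integrable) auto
  moreover have "at x within ({1..\<gamma>} - {}) = at x"
    using x by (intro at_within_interior) auto
  ultimately show ?thesis
    by (simp add: has_real_derivative_iff_has_vector_derivative)
qed

lemma travel_time_strict_mono:
  assumes "1 \<le> x" "x < y" "y \<le> \<gamma>"
  shows "travel_time \<gamma> x < travel_time \<gamma> y"
proof (rule DERIV_pos_imp_increasing_open[OF assms(2)])
  show "continuous_on {x..y} (travel_time \<gamma>)"
    by (rule continuous_on_subset[OF continuous_on_travel_time]) (use assms in auto)
  fix z assume "x < z" "z < y"
  then have "1 < z" "z < \<gamma>" using assms by auto
  then show "\<exists>D. (travel_time \<gamma> has_real_derivative D) (at z) \<and> D > 0"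
    using travel_time_has_derivative top_speed_pos by (intro exI[of _ "1 / top_speed \<gamma> z"]) auto
qed

section \<open>The bang-bang trajectory\<close>

lemma travel_time_image:
  assumes g: "\<gamma> > 1"
  shows "travel_time \<gamma> ` {1..\<gamma>} = {0..travel_time \<gamma> \<gamma>}"
proof
  have mono: "travel_time \<gamma> x \<le> travel_time \<gamma> y" if "1 \<le> x" "x \<le> y" "y \<le> \<gamma>" for x y
    using travel_time_strict_mono[of x y \<gamma>] that by (cases "x = y") auto
  show "travel_time \<gamma> ` {1..\<gamma>} \<subseteq> {0..travel_time \<gamma> \<gamma>}"
    using mono[of 1] mono[of _ \<gamma>] by auto
  show "{0..travel_time \<gamma> \<gamma>} \<subseteq> travel_time \<gamma> ` {1..\<gamma>}"
  proof
    fix t assume "t \<in> {0..travel_time \<gamma> \<gamma>}"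
    then obtain x where "1 \<le> x" "x \<le> \<gamma>" "travel_time \<gamma> x = t"
      using IVT'[of "travel_time \<gamma>" 1 t \<gamma>] continuous_on_travel_time[OF g] g by auto
    then show "t \<in> travel_time \<gamma> ` {1..\<gamma>}" by auto
  qed
qed

text \<open>
  By the chain rule this says that a motion at top speed solves the control system, with
  \<open>u = -1\<close> before the switching point and \<open>u = 1\<close> after it.
\<close>

lemma top_speed_has_derivative:
  assumes x: "1 < x" "x < \<gamma>" "x \<noteq> switch_point \<gamma>"
  shows "(top_speed \<gamma> has_real_derivative
           ((if x < switch_point \<gamma> then 1 else - 1) * x + 1 / x\<^sup>2) / top_speed \<gamma> x) (at x)"
proof (cases "x < switch_point \<gamma>")
  case True
  have eq: "top_speed \<gamma> y = sqrt (accel_bound y)" if "y \<in> {1<..<switch_point \<gamma>}" for y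
    using accel_less_brake_iff[of y \<gamma>] that by (simp add: top_speed_def)
  have "accel_bound x > 0"
    using eq[of x] top_speed_pos[of x \<gamma>] x True by simp
  then have "((\<lambda>y. sqrt (accel_bound y)) has_real_derivative (x + 1 / x\<^sup>2) / sqrt (accel_bound x)) (at x)"
    unfolding accel_bound_def using x
    by (auto intro!: derivative_eq_intros simp: field_simps power2_eq_square)
  then have "(top_speed \<gamma> has_real_derivative (x + 1 / x\<^sup>2) / sqrt (accel_bound x)) (at x)"
    by (rule has_field_derivative_transform_within_open[of _ _ _ "{1<..<switch_point \<gamma>}"])
      (use x True eq in auto)
  then show ?thesis using True eq[of x] x by simp
next
  case False
  have eq: "top_speed \<gamma> y = sqrt (brake_bound \<gamma> y)" if "y \<in> {max 1 (switch_point \<gamma>)<..<\<gamma>}" for y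
    using accel_less_brake_iff[of y \<gamma>] that by (simp add: top_speed_def)
  have "brake_bound \<gamma> x > 0"
    using eq[of x] top_speed_pos[of x \<gamma>] x False by simp
  then have "((\<lambda>y. sqrt (brake_bound \<gamma> y)) has_real_derivative (- x + 1 / x\<^sup>2) / sqrt (brake_bound \<gamma> x)) (at x)"
    unfolding brake_bound_def using x
    by (auto intro!: derivative_eq_intros simp: field_simps power2_eq_square)
  then have "(top_speed \<gamma> has_real_derivative (- x + 1 / x\<^sup>2) / sqrt (brake_bound \<gamma> x)) (at x)"
    by (rule has_field_derivative_transform_within_open[of _ _ _ "{max 1 (switch_point \<gamma>)<..<\<gamma>}"])
      (use x False eq in auto)
  then show ?thesis using False eq[of x] x by simp
qed

lemma AE_lebesgue_on_finite:
  assumes "finite F" "S \<in> sets lebesgue" "\<And>t. t \<in> S - F \<Longrightarrow> P t"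
  shows "AE t in lebesgue_on S. P t"
proof -
  have "F \<in> null_sets lebesgue"
    using assms(1) by (simp add: negligible_iff_null_sets[symmetric] negligible_finite)
  then have "AE t in lebesgue. t \<notin> F"
    by (rule AE_not_in)
  then show ?thesis
    using assms(2,3) by (subst AE_restrict_space_iff) (auto elim!: eventually_mono)
qed

text \<open>
  No solution theory for differential equations is involved: the position as a function of time is
  the inverse of the travel time as a function of position. It moves at top speed because
  its derivative is the reciprocal of \<open>1 / top_speed \<gamma>\<close>. The endpoints, where the top speed is zero,
  and the switching instant form a null set.
\<close>

lemma transfer_time_travel_time:
  assumes g: "\<gamma> > 1"
  shows "transfer_time \<gamma> (travel_time \<gamma> \<gamma>)"
proof -
  define T where "T = travel_time \<gamma> \<gamma>"
  define X where "X = the_inv_into {1..\<gamma>} (travel_time \<gamma>)"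
  define V where "V t = top_speed \<gamma> (X t)" for t
  define u where "u t = (if X t < switch_point \<gamma> then - 1 else 1 :: real)" for t
  define F where "F = {travel_time \<gamma> (switch_point \<gamma>)}"
  have inj: "inj_on (travel_time \<gamma>) {1..\<gamma>}"
  proof (rule linorder_inj_onI)
    fix x y assume "x < y" "x \<in> {1..\<gamma>}" "y \<in> {1..\<gamma>}"
    then show "travel_time \<gamma> x \<noteq> travel_time \<gamma> y"
      using travel_time_strict_mono[of x y \<gamma>] by auto
  qed auto
  have T0: "T \<ge> 0" using travel_time_strict_mono[of 1 \<gamma> \<gamma>] g by (simp add: T_def)
  have X_in: "X t \<in> {1..\<gamma>}" and X_inv: "travel_time \<gamma> (X t) = t" if "t \<in> {0..T}" for t
    using the_inv_into_into[OF inj, of t "{1..\<gamma>}"] f_the_inv_into_f[OF inj, of t] that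
    unfolding travel_time_image[OF g] X_def T_def by auto
  have X_at: "X (travel_time \<gamma> x) = x" if "x \<in> {1..\<gamma>}" for x
    unfolding X_def by (rule the_inv_into_f_f[OF inj that])
  have X_0: "X 0 = 1" and X_T: "X T = \<gamma>"
    using X_at[of 1] X_at[of \<gamma>] g by (auto simp: T_def)
  have X_cont: "continuous_on {0..T} X"
    using continuous_on_inv_into[OF continuous_on_travel_time[OF g] _ inj]
    unfolding X_def T_def travel_time_image[OF g] by simp
  have V_cont: "continuous_on {0..T} V"
    unfolding V_def
    by (rule continuous_on_compose2[OF continuous_on_top_speed X_cont, of "{1..\<gamma>}"]) (use X_in in auto)
  have X_strict: "1 < X t" "X t < \<gamma>" if "t \<in> {0<..<T}" for t
  proof -
    have "X t \<noteq> 1" "X t \<noteq> \<gamma>" using X_inv[of t] that by (auto simp: T_def)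
    then show "1 < X t" "X t < \<gamma>" using X_in[of t] that by auto
  qed
  have V_range: "0 \<le> V t" "V t \<le> \<gamma> + 1" if "t \<in> {0..T}" for t
    using top_speed_nonneg[OF g X_in[OF that]] top_speed_le[of "X t" \<gamma>] X_in[OF that] by (auto simp: V_def)
  have V_pos: "V t > 0" if "t \<in> {0<..<T}" for t
    using top_speed_pos X_strict[OF that] by (simp add: V_def)
  have X_deriv: "(X has_real_derivative V t) (at t)" if t: "t \<in> {0<..<T}" for t
  proof -
    have "isCont X t"
      using continuous_on_interior[OF X_cont] t by simp
    then have "(X has_real_derivative inverse (1 / top_speed \<gamma> (X t))) (at t)"
      using X_strict[OF t] V_pos[OF t] t X_inv
      by (intro DERIV_inverse_function[where f = "travel_time \<gamma>" and a = 0 and b = T] travel_time_has_derivative)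
        (auto simp: V_def)
    then show ?thesis by (simp add: V_def)
  qed
  have V_deriv: "(V has_real_derivative - u t * X t + 1 / (X t)\<^sup>2) (at t)"
    if t: "t \<in> {0<..<T} - F" for t
  proof -
    have "X t \<noteq> switch_point \<gamma>"
      using X_inv[of t] t by (auto simp: F_def)
    then have "((\<lambda>t. top_speed \<gamma> (X t)) has_real_derivative
        ((if X t < switch_point \<gamma> then 1 else - 1) * X t + 1 / (X t)\<^sup>2) / top_speed \<gamma> (X t) * V t) (at t)"
      using X_strict[of t] t by (intro DERIV_chain2[OF top_speed_has_derivative X_deriv]) auto
    moreover have "top_speed \<gamma> (X t) > 0"
      using V_pos[of t] t by (simp add: V_def)
    ultimately show ?thesis
      by (cases "X t < switch_point \<gamma>") (simp_all add: u_def V_def [abs_def])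
  qed
  have force_le: "\<bar>- u t * X t + 1 / (X t)\<^sup>2\<bar> \<le> \<gamma> + 1" if "t \<in> {0..T}" for t
  proof -
    have "0 \<le> 1 / (X t)\<^sup>2" "1 / (X t)\<^sup>2 \<le> 1"
      using X_in[OF that] by (auto simp: divide_le_eq_1)
    moreover have "1 \<le> X t" "X t \<le> \<gamma>" using X_in[OF that] by auto
    ultimately show ?thesis
      by (cases "X t < switch_point \<gamma>"; simp only: u_def if_True if_False; linarith)
  qed
  have "admissible_control T u"
    unfolding admissible_control_def
  proof
    have "X \<in> borel_measurable (lebesgue_on {0..T})"
      by (rule continuous_imp_measurable_on_sets_lebesgue[OF X_cont]) simp
    then show "u \<in> borel_measurable (lebesgue_on {0..T})"
      unfolding u_def [abs_def] by measurable
  qed (auto simp: u_def)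
  moreover have "trajectory T u X V"
    unfolding trajectory_def
  proof (intro conjI ballI)
    show "absolutely_continuous_on {0..T} X"
      by (rule absolutely_continuous_on_bounded_derivative[where f' = V and S = "{}" and C = "\<gamma> + 1"])
        (use X_cont X_deriv V_range g in auto)
    show "absolutely_continuous_on {0..T} V"
    proof (rule absolutely_continuous_on_bounded_derivative[OF V_cont _ V_deriv])
      show "\<bar>- u t * X t + 1 / (X t)\<^sup>2\<bar> \<le> \<gamma> + 1" if "t \<in> {0<..<T} - F" for t
        by (rule force_le) (use that in auto)
    qed (use g in \<open>auto simp: F_def\<close>)
    show "(X t, V t) \<in> state_space" if "t \<in> {0..T}" for t
      using X_in[OF that] V_range[OF that] by (auto simp: state_space_def)
    show "AE t in lebesgue_on {0..T}. (X has_real_derivative V t) (at t within {0..T}) \<and>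
        (V has_real_derivative - u t * X t + 1 / (X t)\<^sup>2) (at t within {0..T})"
    proof (rule AE_lebesgue_on_finite[of "insert 0 (insert T F)"])
      fix t assume "t \<in> {0..T} - insert 0 (insert T F)"
      then have "t \<in> {0<..<T} - F" by auto
      then show "(X has_real_derivative V t) (at t within {0..T}) \<and>
          (V has_real_derivative - u t * X t + 1 / (X t)\<^sup>2) (at t within {0..T})"
        using X_deriv[of t] V_deriv[of t] by (blast intro: has_field_derivative_at_within)
    qed (auto simp: F_def)
  qed
  moreover have "V 0 = 0" "V T = 0"
    using top_speed_endpoints[OF g] by (simp_all add: V_def X_0 X_T)
  ultimately show ?thesis
    unfolding transfer_time_def T_def[symmetric] using T0 X_0 X_T by blast
qed

section \<open>No admissible transfer is faster\<close>

lemma AE_lebesgue_onE: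
  assumes "AE t in lebesgue_on S. P t" "S \<in> sets lebesgue"
  obtains N where "negligible N" "\<And>t. t \<in> S - N \<Longrightarrow> P t"
proof -
  have "AE t in lebesgue. t \<in> S \<longrightarrow> P t"
    using assms by (subst (asm) AE_restrict_space_iff) auto
  then obtain N where "N \<in> null_sets lebesgue" "{t. \<not> (t \<in> S \<longrightarrow> P t)} \<subseteq> N"
    unfolding eventually_ae_filter by auto
  then show thesis
    using that[of N] by (auto simp: negligible_iff_null_sets)
qed

text \<open>
  The energies \<open>accel_bound (x\<^sub>1 t) - (x\<^sub>2 t)\<^sup>2\<close> and \<open>(x\<^sub>2 t)\<^sup>2 - brake_bound \<gamma> (x\<^sub>1 t)\<close> have
  derivatives \<open>2 x\<^sub>1 x\<^sub>2 (1 + u)\<close> and \<open>2 x\<^sub>1 x\<^sub>2 (1 - u)\<close>, so both increase. The first vanishes at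
  the start and the second at the end, so \<open>x\<^sub>2 \<le> top_speed \<gamma> x\<^sub>1\<close> throughout. Therefore
  \<open>t - travel_time \<gamma> (x\<^sub>1 t)\<close> increases as well.
  
  The last function need not be a Lipschitz function of time and position, as the derivative
  \<open>1 / top_speed \<gamma>\<close> of the travel time is unbounded near \<open>1\<close> and \<open>\<gamma>\<close>. Therefore the comparison is first
  made between interior positions \<open>p < q\<close>, which then tend to the endpoints.
\<close>

lemma travel_time_minimal:
  assumes g: "\<gamma> > 1" and tr: "transfer_time \<gamma> T"
  shows "travel_time \<gamma> \<gamma> \<le> T"
proof -
  obtain u x1 x2 where T: "T \<ge> 0" and adm: "admissible_control T u" and traj: "trajectory T u x1 x2"
    and init: "x1 0 = 1" "x2 0 = 0" and final: "x1 T = \<gamma>" "x2 T = 0"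
    using tr unfolding transfer_time_def by auto
  have ac1: "absolutely_continuous_on {0..T} x1" and ac2: "absolutely_continuous_on {0..T} x2"
    and x2_nonneg: "\<And>t. t \<in> {0..T} \<Longrightarrow> x2 t \<ge> 0"
    using traj by (auto simp: trajectory_def state_space_def)
  have "AE t in lebesgue_on {0..T}. (-1 \<le> u t \<and> u t \<le> 1) \<and>
      (x1 has_real_derivative x2 t) (at t within {0..T}) \<and>
      (x2 has_real_derivative - u t * x1 t + 1 / (x1 t)\<^sup>2) (at t within {0..T})"
    using adm traj by (auto simp: admissible_control_def trajectory_def)
  then obtain N where N: "negligible N"
    and u: "\<And>t. t \<in> {0..T} - N \<Longrightarrow> -1 \<le> u t \<and> u t \<le> 1"
    and x1': "\<And>t. t \<in> {0..T} - N \<Longrightarrow> (x1 has_real_derivative x2 t) (at t within {0..T})"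
    and x2': "\<And>t. t \<in> {0..T} - N \<Longrightarrow>
        (x2 has_real_derivative - u t * x1 t + 1 / (x1 t)\<^sup>2) (at t within {0..T})"
    by (rule AE_lebesgue_onE) auto
  have cont1: "continuous_on {0..T} x1" and cont2: "continuous_on {0..T} x2"
    using ac1 ac2 by (simp_all add: absolutely_continuous_on_imp_continuous_on)
  have mono: "x1 s \<le> x1 t" if st: "0 \<le> s" "s \<le> t" "t \<le> T" for s t
  proof (rule absolutely_continuous_on_mono[OF _ st(2) N, where f' = x2])
    show "absolutely_continuous_on {s..t} x1"
      by (rule absolutely_continuous_on_subset[OF ac1]) (use st in auto)
    show "(x1 has_real_derivative x2 r) (at r within {s..t})" if "r \<in> {s..t} - N" for r
      by (rule DERIV_subset[OF x1']) (use st that in auto)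
  qed (use st x2_nonneg in auto)
  have x1_range: "x1 t \<in> {1..\<gamma>}" if "t \<in> {0..T}" for t
    using mono[of 0 t] mono[of t T] that init final by auto
  obtain M where M: "M > 0" "\<And>t. t \<in> {0..T} \<Longrightarrow> x2 t \<le> M"
  proof -
    have "bounded (x2 ` {0..T})"
      by (intro compact_imp_bounded compact_continuous_image cont2) simp
    then obtain M where "M > 0" "\<And>t. t \<in> {0..T} \<Longrightarrow> norm (x2 t) \<le> M"
      unfolding bounded_pos by auto
    then show thesis using that[of M] by fastforce
  qed
  have sq1: "\<bar>(x1 t)\<^sup>2 - (x1 s)\<^sup>2\<bar> \<le> 2 * \<gamma> * \<bar>x1 t - x1 s\<bar>"
    and inv1: "\<bar>2 / x1 t - 2 / x1 s\<bar> \<le> 2 * \<bar>x1 t - x1 s\<bar>"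
    and sq2: "\<bar>(x2 t)\<^sup>2 - (x2 s)\<^sup>2\<bar> \<le> 2 * M * \<bar>x2 t - x2 s\<bar>"
    if st: "s \<in> {0..T}" "t \<in> {0..T}" for s t
  proof -
    note x1st = x1_range[OF st(1)] x1_range[OF st(2)]
    have "\<bar>(x1 t)\<^sup>2 - (x1 s)\<^sup>2\<bar> = \<bar>x1 t + x1 s\<bar> * \<bar>x1 t - x1 s\<bar>"
      by (simp add: power2_eq_square algebra_simps flip: abs_mult)
    also have "\<dots> \<le> 2 * \<gamma> * \<bar>x1 t - x1 s\<bar>"
      using x1st by (intro mult_right_mono) auto
    finally show "\<bar>(x1 t)\<^sup>2 - (x1 s)\<^sup>2\<bar> \<le> 2 * \<gamma> * \<bar>x1 t - x1 s\<bar>" .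
    have "\<bar>(x2 t)\<^sup>2 - (x2 s)\<^sup>2\<bar> = \<bar>x2 t + x2 s\<bar> * \<bar>x2 t - x2 s\<bar>"
      by (simp add: power2_eq_square algebra_simps flip: abs_mult)
    also have "\<dots> \<le> 2 * M * \<bar>x2 t - x2 s\<bar>"
      using M(2)[OF st(1)] M(2)[OF st(2)] x2_nonneg[OF st(1)] x2_nonneg[OF st(2)]
      by (intro mult_right_mono) auto
    finally show "\<bar>(x2 t)\<^sup>2 - (x2 s)\<^sup>2\<bar> \<le> 2 * M * \<bar>x2 t - x2 s\<bar>" .
    have "2 / x1 t - 2 / x1 s = 2 / (x1 t * x1 s) * (x1 s - x1 t)"
      using x1st by (auto simp: field_simps)
    then have "\<bar>2 / x1 t - 2 / x1 s\<bar> = \<bar>2 / (x1 t * x1 s)\<bar> * \<bar>x1 t - x1 s\<bar>"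
      by (simp only: abs_mult abs_minus_commute)
    also have "\<dots> \<le> 2 * \<bar>x1 t - x1 s\<bar>"
    proof (rule mult_right_mono)
      have "1 \<le> x1 t * x1 s" using x1st mult_mono[of 1 "x1 t" 1 "x1 s"] by auto
      then show "\<bar>2 / (x1 t * x1 s)\<bar> \<le> 2" by (simp add: field_simps)
    qed simp
    finally show "\<bar>2 / x1 t - 2 / x1 s\<bar> \<le> 2 * \<bar>x1 t - x1 s\<bar>" .
  qed
  define C where "C = 2 * \<gamma> + 2 + 2 * M"
  have C: "C > 0" using g M by (simp add: C_def)
  have lip: "2 * \<gamma> * \<bar>a\<bar> + 2 * \<bar>a\<bar> + 2 * M * \<bar>b\<bar> \<le> C * (\<bar>a\<bar> + \<bar>b\<bar>)" for a b
  proof -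
    have "C * (\<bar>a\<bar> + \<bar>b\<bar>) = 2 * \<gamma> * \<bar>a\<bar> + 2 * \<bar>a\<bar> + 2 * M * \<bar>b\<bar> + (2 * M * \<bar>a\<bar> + (2 * \<gamma> + 2) * \<bar>b\<bar>)"
      by (simp add: C_def algebra_simps)
    moreover have "0 \<le> 2 * M * \<bar>a\<bar> + (2 * \<gamma> + 2) * \<bar>b\<bar>"
      using g M by (intro add_nonneg_nonneg mult_nonneg_nonneg) auto
    ultimately show ?thesis by linarith
  qed
  have accel: "(x2 t)\<^sup>2 \<le> accel_bound (x1 t)" if t: "t \<in> {0..T}" for t
  proof -
    let ?E = "\<lambda>t. accel_bound (x1 t) - (x2 t)\<^sup>2"
    have "?E 0 \<le> ?E t"
    proof (rule absolutely_continuous_on_mono[OF _ _ N, where f = ?E and f' = "\<lambda>s. 2 * (x1 s * x2 s) * (1 + u s)"])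
      show "absolutely_continuous_on {0..t} ?E"
      proof (rule absolutely_continuous_on_subset[OF absolutely_continuous_on_compose2[OF ac1 ac2 _ C]])
        fix r s assume "r \<in> {0..T}" "s \<in> {0..T}"
        from sq1[OF this] inv1[OF this] sq2[OF this] lip[of "x1 s - x1 r" "x2 s - x2 r"]
        show "\<bar>?E s - ?E r\<bar> \<le> C * (\<bar>x1 s - x1 r\<bar> + \<bar>x2 s - x2 r\<bar>)"
          unfolding accel_bound_def by linarith
      qed (use t in auto)
      fix s assume "s \<in> {0..t} - N"
      then have s: "s \<in> {0..T} - N" using t by auto
      have "x1 s \<noteq> 0" using x1_range[of s] s by auto
      then have "(?E has_real_derivative 2 * (x1 s * x2 s) * (1 + u s)) (at s within {0..T})"
        unfolding accel_bound_def
        by (auto intro!: derivative_eq_intros x1'[OF s] x2'[OF s] simp: field_simps power2_eq_square)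
      then show "(?E has_real_derivative 2 * (x1 s * x2 s) * (1 + u s)) (at s within {0..t})"
        by (rule DERIV_subset) (use t in auto)
      show "0 \<le> 2 * (x1 s * x2 s) * (1 + u s)"
        using u[OF s] x1_range[of s] x2_nonneg[of s] s by (intro mult_nonneg_nonneg) auto
    qed (use t in auto)
    then show ?thesis by (simp add: init accel_bound_def)
  qed
  have brake: "(x2 t)\<^sup>2 \<le> brake_bound \<gamma> (x1 t)" if t: "t \<in> {0..T}" for t
  proof -
    let ?E = "\<lambda>t. (x2 t)\<^sup>2 - brake_bound \<gamma> (x1 t)"
    have "?E t \<le> ?E T"
    proof (rule absolutely_continuous_on_mono[OF _ _ N, where f = ?E and f' = "\<lambda>s. 2 * (x1 s * x2 s) * (1 - u s)"])
      show "absolutely_continuous_on {t..T} ?E"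
      proof (rule absolutely_continuous_on_subset[OF absolutely_continuous_on_compose2[OF ac1 ac2 _ C]])
        fix r s assume "r \<in> {0..T}" "s \<in> {0..T}"
        from sq1[OF this] inv1[OF this] sq2[OF this] lip[of "x1 s - x1 r" "x2 s - x2 r"]
        show "\<bar>?E s - ?E r\<bar> \<le> C * (\<bar>x1 s - x1 r\<bar> + \<bar>x2 s - x2 r\<bar>)"
          unfolding brake_bound_def by linarith
      qed (use t in auto)
      fix s assume "s \<in> {t..T} - N"
      then have s: "s \<in> {0..T} - N" using t by auto
      have "x1 s \<noteq> 0" using x1_range[of s] s by auto
      then have "(?E has_real_derivative 2 * (x1 s * x2 s) * (1 - u s)) (at s within {0..T})"
        unfolding brake_bound_def
        by (auto intro!: derivative_eq_intros x1'[OF s] x2'[OF s] simp: field_simps power2_eq_square)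
      then show "(?E has_real_derivative 2 * (x1 s * x2 s) * (1 - u s)) (at s within {t..T})"
        by (rule DERIV_subset) (use t in auto)
      show "0 \<le> 2 * (x1 s * x2 s) * (1 - u s)"
        using u[OF s] x1_range[of s] x2_nonneg[of s] s by (intro mult_nonneg_nonneg) auto
    qed (use t in auto)
    then show ?thesis by (simp add: final brake_bound_def)
  qed
  have speed: "x2 t \<le> top_speed \<gamma> (x1 t)" if "t \<in> {0..T}" for t
    unfolding top_speed_def using accel[OF that] brake[OF that] by (intro real_le_rsqrt) simp
  have inner: "travel_time \<gamma> q - travel_time \<gamma> p \<le> T" if pq: "1 < p" "p < q" "q < \<gamma>" for p q
  proof -
    obtain t1 where t1: "0 \<le> t1" "t1 \<le> T" "x1 t1 = p"
      using IVT'[of x1 0 p T] cont1 T pq init final by auto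
    obtain t2 where t2: "0 \<le> t2" "t2 \<le> T" "x1 t2 = q"
      using IVT'[of x1 0 q T] cont1 T pq init final by auto
    have t12: "t1 \<le> t2"
      using mono[of t2 t1] t1 t2 pq by (cases "t1 \<le> t2") auto
    have x1_pq: "x1 t \<in> {p..q}" if "t \<in> {t1..t2}" for t
      using mono[of t1 t] mono[of t t2] t1 t2 that by auto
    have nonzero: "top_speed \<gamma> x \<noteq> 0" if "x \<in> {p..q}" for x
      using top_speed_pos[of x \<gamma>] pq that by auto
    have "bounded ((\<lambda>x. 1 / top_speed \<gamma> x) ` {p..q})"
    proof (intro compact_imp_bounded compact_continuous_image)
      show "continuous_on {p..q} (\<lambda>x. 1 / top_speed \<gamma> x)"
        by (intro continuous_intros continuous_on_top_speed) (use nonzero pq in auto)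
    qed simp
    then obtain L where L: "L > 0" "\<And>x. x \<in> {p..q} \<Longrightarrow> norm (1 / top_speed \<gamma> x) \<le> L"
      unfolding bounded_pos by auto
    have lip: "\<bar>travel_time \<gamma> y - travel_time \<gamma> x\<bar> \<le> L * \<bar>y - x\<bar>" if "x \<in> {p..q}" "y \<in> {p..q}" for x y
    proof -
      have "norm (travel_time \<gamma> y - travel_time \<gamma> x) \<le> L * norm (y - x)"
      proof (rule field_differentiable_bound[where S = "{p..q}" and f' = "\<lambda>x. 1 / top_speed \<gamma> x"])
        fix z assume "z \<in> {p..q}"
        then show "(travel_time \<gamma> has_real_derivative 1 / top_speed \<gamma> z) (at z within {p..q})"
          using pq by (intro has_field_derivative_at_within[OF travel_time_has_derivative]) auto
      qed (use that L(2) in auto)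
      then show ?thesis by simp
    qed
    let ?D = "\<lambda>t. t - travel_time \<gamma> (x1 t)"
    have "?D t1 \<le> ?D t2"
    proof (rule absolutely_continuous_on_mono[OF _ t12 N, where f = ?D and f' = "\<lambda>t. 1 - 1 / top_speed \<gamma> (x1 t) * x2 t"])
      have ac1': "absolutely_continuous_on {t1..t2} x1"
        by (rule absolutely_continuous_on_subset[OF ac1]) (use t1 t2 in auto)
      show "absolutely_continuous_on {t1..t2} ?D"
      proof (rule absolutely_continuous_on_compose2[OF absolutely_continuous_on_ident ac1'])
        fix s t assume st: "s \<in> {t1..t2}" "t \<in> {t1..t2}"
        have "\<bar>?D t - ?D s\<bar> \<le> \<bar>t - s\<bar> + L * \<bar>x1 t - x1 s\<bar>"
          using lip[OF x1_pq[OF st(1)] x1_pq[OF st(2)]] by linarith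
        also have "\<dots> \<le> (1 + L) * (\<bar>t - s\<bar> + \<bar>x1 t - x1 s\<bar>)"
          using L(1) by (simp add: algebra_simps)
        finally show "\<bar>?D t - ?D s\<bar> \<le> (1 + L) * (\<bar>t - s\<bar> + \<bar>x1 t - x1 s\<bar>)" .
      qed (use L in simp)
      fix t assume t: "t \<in> {t1..t2} - N"
      then have t': "t \<in> {0..T} - N" using t1 t2 by auto
      have x1t: "1 < x1 t" "x1 t < \<gamma>" using x1_pq[of t] t pq by auto
      have "(x1 has_real_derivative x2 t) (at t within {t1..t2})"
        by (rule DERIV_subset[OF x1'[OF t']]) (use t1 t2 in auto)
      from DERIV_chain2[OF travel_time_has_derivative[OF x1t] this]
      show "(?D has_real_derivative 1 - 1 / top_speed \<gamma> (x1 t) * x2 t) (at t within {t1..t2})"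
        by (auto intro!: derivative_eq_intros)
      show "0 \<le> 1 - 1 / top_speed \<gamma> (x1 t) * x2 t"
        using speed[of t] t' top_speed_pos[OF x1t] by (simp add: divide_le_eq_1)
    qed
    then show ?thesis using t1 t2 by simp
  qed
  define h where "h = (\<gamma> - 1) / 2"
  have h: "0 < h" "1 + h = \<gamma> - h" using g by (auto simp: h_def field_simps)
  define gap where "gap \<epsilon> = travel_time \<gamma> (\<gamma> - \<epsilon>) - travel_time \<gamma> (1 + \<epsilon>)" for \<epsilon>
  have "gap 0 \<le> T"
  proof (rule continuous_le_on_closure[where f = gap and S = "{0<..<h}"])
    have "continuous_on {0..h} gap"
      unfolding gap_def
      by (intro continuous_intros continuous_on_compose2[OF continuous_on_travel_time[OF g]])
        (use h in auto)
    then show "continuous_on (closure {0<..<h}) gap"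
      using h(1) by simp
    show "0 \<in> closure {0<..<h}" using h(1) by simp
    show "gap \<epsilon> \<le> T" if "\<epsilon> \<in> {0<..<h}" for \<epsilon>
      unfolding gap_def using that h by (intro inner) auto
  qed
  then show ?thesis by (simp add: gap_def)
qed

lemma minimum_time_eq:
  assumes "\<gamma> > 1"
  shows "minimum_time \<gamma> = travel_time \<gamma> \<gamma>"
  unfolding minimum_time_def
  using transfer_time_travel_time[OF assms] travel_time_minimal[OF assms] by (rule Least_equality)

section \<open>Logarithmic growth of the travel time\<close>

lemma travel_time_le:
  assumes g: "\<gamma> > 1"
  shows "travel_time \<gamma> \<gamma> \<le> ln \<gamma> + (ln 2 + 2)"
proof -
  have "travel_time \<gamma> \<gamma> \<le> arcosh \<gamma> + 2 * sqrt (\<gamma> - 1) / sqrt (\<gamma> + 1 - 2 / \<gamma>)"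
    unfolding travel_time_def
    by (rule has_integral_le[OF integrable_integral[OF inverse_top_speed_integrable[OF g]]
          majorant_has_integral[OF g] inverse_top_speed_le[OF g]])
  moreover have "sqrt (\<gamma> - 1) / sqrt (\<gamma> + 1 - 2 / \<gamma>) \<le> 1"
    using brake_slope_gt[OF g] g by (simp add: divide_le_eq_1)
  moreover have "arcosh \<gamma> \<le> ln (2 * \<gamma>)"
  proof -
    have "sqrt (\<gamma>\<^sup>2 - 1) \<le> \<gamma>" using g by (intro real_le_lsqrt) auto
    moreover have "0 \<le> sqrt (\<gamma>\<^sup>2 - 1)" using g by simp
    ultimately show ?thesis unfolding arcosh_real_def[OF less_imp_le[OF g]]
      using g by (subst ln_le_cancel_iff) (linarith | simp)+
  qed
  ultimately show ?thesis using g by (simp add: ln_mult)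
qed

lemma travel_time_ge:
  assumes g: "\<gamma> > 1"
  shows "ln \<gamma> - ln 2 \<le> travel_time \<gamma> \<gamma>"
proof -
  \<comment> \<open>The integrand \<open>1 / top_speed \<gamma>\<close> takes the default value 0 at the endpoints, so the minorant is 0 there too.\<close>
  have "((\<lambda>x. if x \<in> {1<..<\<gamma>} then 1 / (x + 1) else 0) has_integral (ln (\<gamma> + 1) - ln (1 + 1))) {1..\<gamma>}"
    by (rule fundamental_theorem_of_calculus_interior)
      (use g in \<open>auto intro!: continuous_intros derivative_eq_intros
         simp flip: has_real_derivative_iff_has_vector_derivative\<close>)
  then have "ln (\<gamma> + 1) - ln (1 + 1) \<le> travel_time \<gamma> \<gamma>"
    unfolding travel_time_def
  proof (rule has_integral_le[OF _ integrable_integral[OF inverse_top_speed_integrable[OF g]]])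
    fix x assume "x \<in> {1..\<gamma>}"
    then show "(if x \<in> {1<..<\<gamma>} then 1 / (x + 1) else 0) \<le> 1 / top_speed \<gamma> x"
      using top_speed_pos[of x \<gamma>] top_speed_le[of x \<gamma>] top_speed_nonneg[OF g, of x]
      by (auto intro!: divide_left_mono)
  qed
  moreover have "ln \<gamma> \<le> ln (\<gamma> + 1)" using g by simp
  ultimately show ?thesis by simp
qed

theorem mainTheorem3:
  shows "((\<lambda>\<gamma>::real. minimum_time \<gamma> / ln \<gamma>) \<longlongrightarrow> 1) at_top"
proof (rule tendsto_sandwich)
  have lim: "((\<lambda>\<gamma>::real. 1 + c / ln \<gamma>) \<longlongrightarrow> 1) at_top" for c :: real
    using tendsto_add[OF tendsto_const
        tendsto_divide_0[OF tendsto_const filterlim_at_top_imp_at_infinity[OF ln_at_top]]] by simp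
  show "((\<lambda>\<gamma>::real. 1 + (- ln 2) / ln \<gamma>) \<longlongrightarrow> 1) at_top" by (rule lim)
  show "((\<lambda>\<gamma>::real. 1 + (ln 2 + 2) / ln \<gamma>) \<longlongrightarrow> 1) at_top" by (rule lim)
  show "\<forall>\<^sub>F \<gamma>::real in at_top. 1 + (- ln 2) / ln \<gamma> \<le> minimum_time \<gamma> / ln \<gamma>"
    using eventually_gt_at_top[of 1]
  proof eventually_elim
    case (elim \<gamma>)
    then have "ln \<gamma> > 0" by simp
    then have "1 + (- ln 2) / ln \<gamma> = (ln \<gamma> - ln 2) / ln \<gamma>" by (simp add: diff_divide_distrib)
    then show ?case
      using travel_time_ge[OF elim] \<open>ln \<gamma> > 0\<close> by (simp add: minimum_time_eq[OF elim] divide_right_mono)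
  qed
  show "\<forall>\<^sub>F \<gamma>::real in at_top. minimum_time \<gamma> / ln \<gamma> \<le> 1 + (ln 2 + 2) / ln \<gamma>"
    using eventually_gt_at_top[of 1]
  proof eventually_elim
    case (elim \<gamma>)
    then have "ln \<gamma> > 0" by simp
    then have "1 + (ln 2 + 2) / ln \<gamma> = (ln \<gamma> + (ln 2 + 2)) / ln \<gamma>" by (simp add: add_divide_distrib)
    then show ?case
      using travel_time_le[OF elim] \<open>ln \<gamma> > 0\<close> by (simp only: minimum_time_eq[OF elim] divide_right_mono less_imp_le)
  qed
qed

end
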